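(* Let $x:=\{x(n)\}_{n=1}^{\infty}\in l^{\infty}$ and suppose $a\in S(x)$. Then $a$ has an essential subsequence if and only if $a$ is an isolated sub-limit of $x$.
   Context: $l^{\infty}$ is the Banach space of bounded sequences of real numbers $x=\{x(n)\}_{n=1}^{\infty}$ with norm $\|x\|_{\infty}=\sup_n|x(n)|$. A real number $a$ is a sub-limit of $x\in l^\infty$ if there is a subsequence $\{x(n_k)\}_{k=1}^{\infty}$ of $x$ with limit $a$; $S(x)$ denotes the set of all sub-limits of $x$. A sub-limit $a$ is isolated if there is $\varepsilon_0>0$ such that $(a-\varepsilon_0,a+\varepsilon_0)\cap S(x)=\{a\}$. For $a\in S(x)$, a subsequence $\{x(n_k)\}_{k=1}^{\infty}$ of $x$ is called an essential subsequence of $a$ if it converges to $a$ and, for any subsequence $\{x(m_t)\}_{t=1}^{\infty}$ of $x$ with limit $a$, all entries of $\{x(m_t)\}$ except finitely many are entries of $\{x(n_k)\}_{k=1}^{\infty}$ (entries are understood as terms of the sequence $x$, i.e. they are identified by their indices). *)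

theory Defs
  imports Complex_Main
begin

text \<open>
  A bounded real sequence is a function \<open>x :: nat \<Rightarrow> real\<close> with \<open>Bseq x\<close>; indices start
  at 0. A subsequence of \<open>x\<close> is given by its strictly increasing index map \<open>r\<close>, the
  subsequence itself being \<open>x \<circ> r\<close>.
\<close>

definition sub_limits :: "(nat \<Rightarrow> real) \<Rightarrow> real set" where
  "sub_limits x = {a. \<exists>r :: nat \<Rightarrow> nat. strict_mono r \<and> (x \<circ> r) \<longlonglongrightarrow> a}"

definition isolated_sub_limit :: "(nat \<Rightarrow> real) \<Rightarrow> real \<Rightarrow> bool" where
  "isolated_sub_limit x a \<longleftrightarrow>
     a \<in> sub_limits x \<and> (\<exists>\<epsilon>>0. {a - \<epsilon><..<a + \<epsilon>} \<inter> sub_limits x = {a})"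

text \<open>
  Entries are identified by their indices, not by their values, so the entries of
  \<open>x \<circ> m\<close> that are not entries of \<open>x \<circ> r\<close> correspond to \<open>range m - range r\<close>.
\<close>

definition essential_subsequence :: "(nat \<Rightarrow> real) \<Rightarrow> real \<Rightarrow> (nat \<Rightarrow> nat) \<Rightarrow> bool" where
  "essential_subsequence x a r \<longleftrightarrow>
     strict_mono r \<and> (x \<circ> r) \<longlonglongrightarrow> a \<and>
     (\<forall>m :: nat \<Rightarrow> nat. strict_mono m \<and> (x \<circ> m) \<longlonglongrightarrow> a \<longrightarrow> finite (range m - range r))"

end

theory Submission
  imports Defs "HOL-Library.Infinite_Set" "HOL-Analysis.Elementary_Normed_Spaces"
begin

text \<open>
  Call the entries whose distance to \<open>a\<close> lies in \<open>[\<delta>, \<epsilon>)\<close> an annulus around \<open>a\<close>.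
  Both sides of the equivalence say the same about the annuli:
  there is \<open>\<epsilon> > 0\<close> such that for every \<open>\<delta> > 0\<close> the annulus contains only finitely many indices.

  If \<open>a\<close> is isolated, an annulus well inside the isolating interval is finite, since otherwise
  Bolzano--Weierstrass would produce a sub-limit in it (\<open>infinite_imp_sub_limit\<close>). Conversely,
  a sub-limit \<open>b \<noteq> a\<close> close to \<open>a\<close> has infinitely many indices near it
  (\<open>sub_limit_imp_infinite_near\<close>) and these lie in an annulus.

  If the annuli are finite, then listing all indices \<open>n\<close> with \<open>\<bar>x n - a\<bar> < \<epsilon>\<close> gives a
  subsequence that converges to \<open>a\<close>, and it is essential because every subsequence with limit \<open>a\<close>
  is eventually inside the \<open>\<epsilon>\<close>-neighbourhood. Conversely, an essential subsequence must contain
  almost all indices of some \<open>\<epsilon>\<close>-neighbourhood, since otherwise indices outside of it could be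
  chosen ever closer to \<open>a\<close> (\<open>infinite_near_imp_subsequence\<close>); convergence
  then leaves only finitely many of them at distance at least \<open>\<delta>\<close>.
\<close>

text \<open>
  This form of convergence depends on the subsequence only through its set of indices, which is
  also all that the definition of an essential subsequence compares.
\<close>

lemma subsequence_tendsto_iff_finite_far:
  fixes x :: "nat \<Rightarrow> real"
  assumes "strict_mono r"
  shows "(x \<circ> r) \<longlonglongrightarrow> a \<longleftrightarrow> (\<forall>\<delta>>0. finite {n \<in> range r. \<delta> \<le> \<bar>x n - a\<bar>})"
proof -
  have "(\<forall>\<^sub>F k in sequentially. dist (x (r k)) a < \<delta>) \<longleftrightarrow> finite {n \<in> range r. \<delta> \<le> \<bar>x n - a\<bar>}" for \<delta>
  proof -
    have "{n \<in> range r. \<delta> \<le> \<bar>x n - a\<bar>} = r ` {k. \<not> dist (x (r k)) a < \<delta>}"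
      by (auto simp: dist_real_def not_less)
    moreover have "inj_on r {k. \<not> dist (x (r k)) a < \<delta>}"
      using assms by (meson inj_on_subset strict_mono_imp_inj_on subset_UNIV)
    ultimately show ?thesis
      by (simp add: finite_image_iff eventually_cofinite flip: cofinite_eq_sequentially)
  qed
  then show ?thesis
    by (simp add: tendsto_iff)
qed

lemma infinite_range_strict_mono:
  fixes r :: "nat \<Rightarrow> nat"
  assumes "strict_mono r"
  shows "infinite (range r)"
  using assms by (simp add: range_inj_infinite strict_mono_imp_inj_on)

lemma sub_limit_imp_infinite_near:
  assumes "b \<in> sub_limits x" "\<delta> > 0"
  shows "infinite {n. \<bar>x n - b\<bar> < \<delta>}"
proof -
  obtain r where r: "strict_mono r" "(x \<circ> r) \<longlonglongrightarrow> b"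
    using assms(1) by (auto simp: sub_limits_def)
  then have "finite {n \<in> range r. \<delta> \<le> \<bar>x n - b\<bar>}"
    using assms(2) subsequence_tendsto_iff_finite_far by blast
  then have "infinite (range r - {n \<in> range r. \<delta> \<le> \<bar>x n - b\<bar>})"
    using infinite_range_strict_mono[OF r(1)] by (rule Diff_infinite_finite)
  then show ?thesis
    by (rule infinite_super[rotated]) auto
qed

lemma infinite_imp_sub_limit:
  assumes "compact K" "infinite {n. x n \<in> K}"
  shows "\<exists>b\<in>K. b \<in> sub_limits x"
proof -
  let ?e = "enumerate {n. x n \<in> K}"
  have "\<forall>k. (x \<circ> ?e) k \<in> K"
    using enumerate_in_set[OF assms(2)] by simp
  then obtain b s where "b \<in> K" "strict_mono s" "((x \<circ> ?e) \<circ> s) \<longlonglongrightarrow> b"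
    using compact_imp_seq_compact[OF assms(1)] unfolding seq_compact_def by metis
  then show ?thesis
    using strict_mono_o[OF strict_mono_enumerate[OF assms(2)], of s]
    by (auto simp: sub_limits_def comp_assoc)
qed

lemma infinite_near_imp_subsequence:
  fixes x :: "nat \<Rightarrow> real"
  assumes inf: "\<And>\<epsilon>. \<epsilon> > 0 \<Longrightarrow> infinite {n \<in> A. \<bar>x n - a\<bar> < \<epsilon>}"
  shows "\<exists>m. strict_mono m \<and> range m \<subseteq> A \<and> (x \<circ> m) \<longlonglongrightarrow> a"
proof -
  let ?P = "\<lambda>k n. n \<in> A \<and> \<bar>x n - a\<bar> < inverse (real (Suc k))"
  have step: "\<exists>n. ?P k n \<and> l < n" for k l
    using inf[of "inverse (real (Suc k))"] by (auto simp: infinite_nat_iff_unbounded)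
  have "\<exists>m. \<forall>k. ?P k (m k) \<and> m k < m (Suc k)"
    by (rule dependent_nat_choice) (use step in blast)+
  then obtain m where m: "\<And>k. ?P k (m k)" "\<And>k. m k < m (Suc k)"
    by blast
  have "(\<lambda>k. x (m k) - a) \<longlonglongrightarrow> 0"
    by (rule Lim_null_comparison[OF _ LIMSEQ_inverse_real_of_nat])
       (use m(1) in \<open>auto intro!: always_eventually less_imp_le\<close>)
  then have "(x \<circ> m) \<longlonglongrightarrow> a"
    by (simp add: LIM_zero_iff comp_def)
  with m show ?thesis
    by (auto simp: strict_mono_Suc_iff)
qed

definition finite_annuli :: "(nat \<Rightarrow> real) \<Rightarrow> real \<Rightarrow> real \<Rightarrow> bool" where
  "finite_annuli x a \<epsilon> \<longleftrightarrow> (\<forall>\<delta>>0. finite {n. \<delta> \<le> \<bar>x n - a\<bar> \<and> \<bar>x n - a\<bar> < \<epsilon>})"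

lemma isolated_sub_limit_iff_finite_annuli:
  assumes "a \<in> sub_limits x"
  shows "isolated_sub_limit x a \<longleftrightarrow> (\<exists>\<epsilon>>0. finite_annuli x a \<epsilon>)"
proof
  assume "isolated_sub_limit x a"
  then obtain \<epsilon> where \<epsilon>: "\<epsilon> > 0" "{a - \<epsilon><..<a + \<epsilon>} \<inter> sub_limits x = {a}"
    by (auto simp: isolated_sub_limit_def)
  have "finite {n. \<delta> \<le> \<bar>x n - a\<bar> \<and> \<bar>x n - a\<bar> < \<epsilon> / 2}" if "\<delta> > 0" for \<delta>
  proof (rule ccontr)
    \<comment> \<open>The radius is halved so that the closed annulus, which is compact, still lies in the
      open isolating interval.\<close>
    let ?K = "{a - \<epsilon> / 2..a - \<delta>} \<union> {a + \<delta>..a + \<epsilon> / 2}"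
    assume "infinite {n. \<delta> \<le> \<bar>x n - a\<bar> \<and> \<bar>x n - a\<bar> < \<epsilon> / 2}"
    then have "infinite {n. x n \<in> ?K}"
      by (rule infinite_super[rotated]) (auto simp: abs_if split: if_splits)
    moreover have "compact ?K"
      by (intro compact_Un compact_Icc)
    ultimately obtain b where "b \<in> ?K" "b \<in> sub_limits x"
      using infinite_imp_sub_limit by blast
    moreover from this have "b \<in> {a - \<epsilon><..<a + \<epsilon>}" "b \<noteq> a"
      using \<epsilon>(1) that by auto
    ultimately show False
      using \<epsilon>(2) by blast
  qed
  then show "\<exists>\<epsilon>>0. finite_annuli x a \<epsilon>"
    using \<epsilon>(1) unfolding finite_annuli_def by (intro exI[of _ "\<epsilon> / 2"]) simp
next
  assume "\<exists>\<epsilon>>0. finite_annuli x a \<epsilon>"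
  then obtain \<epsilon> where \<epsilon>: "\<epsilon> > 0" "finite_annuli x a \<epsilon>"
    by blast
  have "b = a" if b: "b \<in> sub_limits x" "\<bar>b - a\<bar> < \<epsilon>" for b
  proof (rule ccontr)
    assume "b \<noteq> a"
    \<comment> \<open>The interval of radius \<open>\<delta>\<close> around \<open>b\<close> stays at distance at least \<open>\<delta>\<close> from \<open>a\<close>
      and inside the neighbourhood of radius \<open>\<epsilon>\<close>.\<close>
    define \<delta> where "\<delta> = min (\<bar>b - a\<bar> / 2) (\<epsilon> - \<bar>b - a\<bar>)"
    have \<delta>: "2 * \<delta> \<le> \<bar>b - a\<bar>" "\<delta> \<le> \<epsilon> - \<bar>b - a\<bar>"
      by (auto simp: \<delta>_def min_def)
    have "\<delta> > 0"
      using \<open>b \<noteq> a\<close> b(2) by (simp add: \<delta>_def)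
    moreover have "{n. \<bar>x n - b\<bar> < \<delta>} \<subseteq> {n. \<delta> \<le> \<bar>x n - a\<bar> \<and> \<bar>x n - a\<bar> < \<epsilon>}"
    proof clarify
      fix n
      assume "\<bar>x n - b\<bar> < \<delta>"
      with \<delta> show "\<delta> \<le> \<bar>x n - a\<bar> \<and> \<bar>x n - a\<bar> < \<epsilon>"
        by linarith
    qed
    ultimately show False
      using \<epsilon>(2) sub_limit_imp_infinite_near[OF b(1)] finite_subset
      unfolding finite_annuli_def by blast
  qed
  then have "{a - \<epsilon><..<a + \<epsilon>} \<inter> sub_limits x = {a}"
    using \<epsilon>(1) assms by (auto simp: abs_less_iff)
  then show "isolated_sub_limit x a"
    using \<epsilon>(1) assms by (auto simp: isolated_sub_limit_def)
qed

lemma ex_essential_subsequence_iff_finite_annuli: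
  assumes "a \<in> sub_limits x"
  shows "(\<exists>r. essential_subsequence x a r) \<longleftrightarrow> (\<exists>\<epsilon>>0. finite_annuli x a \<epsilon>)"
proof
  assume "\<exists>r. essential_subsequence x a r"
  then obtain r where r: "strict_mono r" "(x \<circ> r) \<longlonglongrightarrow> a"
    and ess: "\<And>m. strict_mono m \<Longrightarrow> (x \<circ> m) \<longlonglongrightarrow> a \<Longrightarrow> finite (range m - range r)"
    by (auto simp: essential_subsequence_def)
  have "\<exists>\<epsilon>>0. finite {n \<in> - range r. \<bar>x n - a\<bar> < \<epsilon>}"
  proof (rule ccontr)
    assume "\<not> (\<exists>\<epsilon>>0. finite {n \<in> - range r. \<bar>x n - a\<bar> < \<epsilon>})"
    then obtain m where m: "strict_mono m" "range m \<subseteq> - range r" "(x \<circ> m) \<longlonglongrightarrow> a"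
      using infinite_near_imp_subsequence[of "- range r" x a] by blast
    then have "range m - range r = range m"
      by blast
    then show False
      using ess[OF m(1,3)] infinite_range_strict_mono[OF m(1)] by simp
  qed
  then obtain \<epsilon> where \<epsilon>: "\<epsilon> > 0" "finite {n \<in> - range r. \<bar>x n - a\<bar> < \<epsilon>}"
    by blast
  have "finite {n. \<delta> \<le> \<bar>x n - a\<bar> \<and> \<bar>x n - a\<bar> < \<epsilon>}" if "\<delta> > 0" for \<delta>
  proof (rule finite_subset)
    show "finite ({n \<in> range r. \<delta> \<le> \<bar>x n - a\<bar>} \<union> {n \<in> - range r. \<bar>x n - a\<bar> < \<epsilon>})"
      using r(2) that \<epsilon>(2) unfolding subsequence_tendsto_iff_finite_far[OF r(1)] by blast
  qed auto
  then show "\<exists>\<epsilon>>0. finite_annuli x a \<epsilon>"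
    using \<epsilon>(1) by (auto simp: finite_annuli_def)
next
  assume "\<exists>\<epsilon>>0. finite_annuli x a \<epsilon>"
  then obtain \<epsilon> where \<epsilon>: "\<epsilon> > 0" "finite_annuli x a \<epsilon>"
    by blast
  let ?N = "{n. \<bar>x n - a\<bar> < \<epsilon>}"
  have inf: "infinite ?N"
    using assms \<epsilon>(1) by (rule sub_limit_imp_infinite_near)
  define r where "r = enumerate ?N"
  have r: "strict_mono r" "range r = ?N"
    using inf by (simp_all add: r_def strict_mono_enumerate range_enumerate)
  have "{n \<in> range r. \<delta> \<le> \<bar>x n - a\<bar>} = {n. \<delta> \<le> \<bar>x n - a\<bar> \<and> \<bar>x n - a\<bar> < \<epsilon>}" for \<delta>
    using r(2) by auto
  then have "(x \<circ> r) \<longlonglongrightarrow> a"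
    using \<epsilon>(2) by (simp add: subsequence_tendsto_iff_finite_far[OF r(1)] finite_annuli_def)
  moreover have "finite (range m - range r)" if "strict_mono m" "(x \<circ> m) \<longlonglongrightarrow> a" for m
  proof -
    have "range m - range r = {n \<in> range m. \<epsilon> \<le> \<bar>x n - a\<bar>}"
      using r(2) by auto
    then show ?thesis
      using that \<epsilon>(1) subsequence_tendsto_iff_finite_far by simp
  qed
  ultimately show "\<exists>r. essential_subsequence x a r"
    using r(1) by (auto simp: essential_subsequence_def)
qed

theorem proposition1p7:
  fixes x :: "nat \<Rightarrow> real" and a :: real
  assumes "Bseq x" and "a \<in> sub_limits x"
  shows "(\<exists>r. essential_subsequence x a r) \<longleftrightarrow> isolated_sub_limit x a"
  by (simp only: ex_essential_subsequence_iff_finite_annuli[OF assms(2)]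
      isolated_sub_limit_iff_finite_annuli[OF assms(2)])

end
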